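(* Let $c,A\in\mathbb{R}$ and $\phi\in[0,1]$. Let $P$ be a real random variable with cumulative distribution function $F$ and $\mathbb{E}[P^+]<\infty$, and let $P_w$ be a real random variable with cumulative distribution function $F_w$. Write $\bar F=1-F$ and $\bar F_w=1-F_w$. Suppose that (i) $F_w(p)=F(p)$ for all $p<c$; and (ii) $(1-\phi)\bar F(p)\le \bar F_w(p)\le \bar F(p)$ for all $p\ge c$. For $K\in\mathbb{R}$ let $$I(K)=\mathbb{E}[(P_w-c)^+]-\mathbb{E}[(P_w-K)^+]+\mathbb{E}[(P-K)^+]-A$$ and $$\underline I(K)=\begin{cases}\mathbb{E}[(P-c)^+]-A, & K\le c,\\[4pt] (1-\phi)\,\mathbb{E}[(P-c)^+]+\phi\,\mathbb{E}[(P-K)^+]-A, & K>c.\end{cases}$$ Then $I(K)\ge \underline I(K)$ for every $K$. Moreover, the bound is tight, in the sense that no uniformly stronger lower bound is possible: for fixed $F,c,A,\phi$ and any $K$, if a real number $J$ satisfies $I(K)\ge J$ for every distribution function $F_w$ satisfying (i) and (ii), then $J\le \underline I(K)$.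
   Context: Notation: $(x)^+=\max\{x,0\}$. Interpretation: $P$ is the observed (baseline) real-time energy price, $P_w$ is the counterfactual price if a given resource prepares and becomes available, $c$ is the resource's short-run marginal cost, $A$ its preparation cost, $\phi$ a bound on its price impact, and $K$ the strike price. $I(K)$ is the incentive value: the expected payoff $\mathbb{E}[(P_w-c)^+]-\mathbb{E}[(P_w-K)^+]-A$ from becoming available minus the expected payoff $-\mathbb{E}[(P-K)^+]$ from remaining unavailable. $I(K)$ depends on $P$ and $P_w$ only through their distribution functions $F$ and $F_w$. *)

theory Defs
  imports "HOL-Probability.Probability"
begin

text \<open>Conditions (i) and (ii): \<open>F\<close> and \<open>Fw\<close> are the distribution functions of the observed and
  the counterfactual price, and \<open>1 - F p\<close>, \<open>1 - Fw p\<close> are the tails.\<close>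

definition admissible_impact ::
  "real \<Rightarrow> real \<Rightarrow> (real \<Rightarrow> real) \<Rightarrow> (real \<Rightarrow> real) \<Rightarrow> bool" where
  "admissible_impact c \<phi> F Fw \<longleftrightarrow>
     (\<forall>p<c. Fw p = F p) \<and>
     (\<forall>p\<ge>c. (1 - \<phi>) * (1 - F p) \<le> 1 - Fw p \<and> 1 - Fw p \<le> 1 - F p)"

text \<open>The two prices may live on different probability spaces \<open>M\<close> and \<open>N\<close>, since the incentive
  value depends on them only through their laws. The Bochner integral of a non-integrable function
  is 0, but this never matters below: the upper bound in (ii) and the integrability of \<open>P\<^sup>+\<close>
  make all the integrands integrable.\<close>

definition incentive_value ::
  "'a measure \<Rightarrow> ('a \<Rightarrow> real) \<Rightarrow> 'b measure \<Rightarrow> ('b \<Rightarrow> real) \<Rightarrow> real \<Rightarrow> real \<Rightarrow> real \<Rightarrow> real" where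
  "incentive_value M P N Pw c A K =
     (\<integral>\<omega>. max (Pw \<omega> - c) 0 \<partial>N) - (\<integral>\<omega>. max (Pw \<omega> - K) 0 \<partial>N)
       + (\<integral>\<omega>. max (P \<omega> - K) 0 \<partial>M) - A"

definition incentive_lower ::
  "'a measure \<Rightarrow> ('a \<Rightarrow> real) \<Rightarrow> real \<Rightarrow> real \<Rightarrow> real \<Rightarrow> real \<Rightarrow> real" where
  "incentive_lower M P c A \<phi> K =
     (if K \<le> c then (\<integral>\<omega>. max (P \<omega> - c) 0 \<partial>M) - A
      else (1 - \<phi>) * (\<integral>\<omega>. max (P \<omega> - c) 0 \<partial>M) + \<phi> * (\<integral>\<omega>. max (P \<omega> - K) 0 \<partial>M) - A)"

end

theory Submission
  imports Defs
begin

text \<open>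
  The expected excess of a price over a strike is the area under its tail beyond the strike,
  \<open>\<E>[(X - a)\<^sup>+] = \<integral>\<^sub>a\<^sup>\<infinity> (1 - F p) dp\<close>. Substituting this for the four expectations turns the incentive
  value into an integral that can be read off pointwise (\<open>incentive_value_strike_le\<close>,
  \<open>incentive_value_strike_gt\<close>).

  If \<open>K \<le> c\<close>, the strike payoffs of the two prices differ only through the tails on \<open>[c, \<infinity>)\<close>,
  because the tails agree below \<open>c\<close>; adding the resource's own profit \<open>\<integral>\<^sub>c\<^sup>\<infinity> (1 - F\<^sub>w p) dp\<close>
  to this difference removes \<open>F\<^sub>w\<close>, so \<open>I(K) = \<E>[(P - c)\<^sup>+] - A\<close>, whatever the impact is. If \<open>K > c\<close>, the tails of the
  counterfactual price beyond \<open>K\<close> cancel, so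
  \<open>I(K) = \<integral>\<^sub>c\<^sup>K (1 - F\<^sub>w p) dp + \<E>[(P - K)\<^sup>+] - A\<close>. This is monotone in the tail \<open>1 - F\<^sub>w\<close>,
  hence the lower bound on the tail gives the lower bound on the incentive value.

  For tightness, the smallest admissible tail, \<open>1 - F\<close> below \<open>c\<close> and \<open>(1 - \<phi>) (1 - F)\<close> from \<open>c\<close> on,
  is itself the tail of a probability law, namely the mixture of the laws of \<open>min P c\<close> and \<open>P\<close>
  with weights \<open>\<phi>\<close> and \<open>1 - \<phi>\<close>. Under this single law the bound is an equality for every \<open>K\<close>.
\<close>

section \<open>Expected excess as a tail integral\<close>

lemma (in prob_space) one_minus_cdf_distr:
  fixes X :: "'a \<Rightarrow> real"
  assumes [measurable]: "X \<in> borel_measurable M"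
  shows "1 - cdf (distr M borel X) p = prob {\<omega> \<in> space M. p < X \<omega>}"
proof -
  have "cdf (distr M borel X) p = prob {\<omega> \<in> space M. X \<omega> \<le> p}"
    unfolding cdf_def by (subst measure_distr) (auto intro!: arg_cong[where f=prob])
  also have "1 - \<dots> = prob {\<omega> \<in> space M. \<not> X \<omega> \<le> p}"
    by (subst prob_neg) auto
  finally show ?thesis by (simp add: not_le)
qed

lemma (in prob_space) borel_measurable_cdf_distr [measurable]:
  fixes X :: "'a \<Rightarrow> real"
  assumes "X \<in> borel_measurable M"
  shows "cdf (distr M borel X) \<in> borel_measurable borel"
proof -
  interpret D: real_distribution "distr M borel X"
    using assms by (rule real_distribution_distr)
  show ?thesis
    by (intro borel_measurable_mono monoI D.cdf_nondecreasing)
qed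

text \<open>For each outcome \<open>(X \<omega> - a)\<^sup>+\<close> is the length of the interval \<open>{a..<X \<omega>}\<close>; exchanging the two
  integrations by Tonelli gives the probability that \<open>p\<close> lies in that interval, integrated over \<open>p\<close>.\<close>

lemma (in prob_space) nn_integral_excess_eq_tail:
  fixes X :: "'a \<Rightarrow> real"
  assumes [measurable]: "X \<in> borel_measurable M"
  shows "(\<integral>\<^sup>+\<omega>. ennreal (max (X \<omega> - a) 0) \<partial>M)
       = (\<integral>\<^sup>+p. ennreal (indicator {a..} p * (1 - cdf (distr M borel X) p)) \<partial>lborel)"
proof -
  interpret pair_sigma_finite lborel M ..
  have "(\<integral>\<^sup>+\<omega>. ennreal (max (X \<omega> - a) 0) \<partial>M)
      = (\<integral>\<^sup>+\<omega>. (\<integral>\<^sup>+p. indicator {(p, \<omega>). a \<le> p \<and> p < X \<omega>} (p, \<omega>) \<partial>lborel) \<partial>M)"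
  proof (intro nn_integral_cong)
    fix \<omega>
    have "(\<integral>\<^sup>+p. indicator {(p, \<omega>). a \<le> p \<and> p < X \<omega>} (p, \<omega>) \<partial>lborel)
        = (\<integral>\<^sup>+p. indicator {a..<X \<omega>} p \<partial>lborel)"
      by (intro nn_integral_cong) (auto simp: indicator_def)
    also have "\<dots> = ennreal (max (X \<omega> - a) 0)"
      by (cases "a \<le> X \<omega>") (auto simp: max_def)
    finally show "ennreal (max (X \<omega> - a) 0)
        = (\<integral>\<^sup>+p. indicator {(p, \<omega>). a \<le> p \<and> p < X \<omega>} (p, \<omega>) \<partial>lborel)" ..
  qed
  also have "\<dots> = (\<integral>\<^sup>+p. (\<integral>\<^sup>+\<omega>. indicator {(p, \<omega>). a \<le> p \<and> p < X \<omega>} (p, \<omega>) \<partial>M) \<partial>lborel)"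
  proof (rule Fubini')
    have "(\<lambda>(p, \<omega>). indicator {(p, \<omega>). a \<le> p \<and> p < X \<omega>} (p, \<omega>))
        = (\<lambda>z. if a \<le> fst z \<and> fst z < X (snd z) then 1 else (0::ennreal))"
      by (auto simp: indicator_def)
    also have "\<dots> \<in> borel_measurable (lborel \<Otimes>\<^sub>M M)" by measurable
    finally show "(\<lambda>(p, \<omega>). indicator {(p, \<omega>). a \<le> p \<and> p < X \<omega>} (p, \<omega>) :: ennreal)
        \<in> borel_measurable (lborel \<Otimes>\<^sub>M M)" .
  qed
  also have "\<dots> = (\<integral>\<^sup>+p. ennreal (indicator {a..} p * (1 - cdf (distr M borel X) p)) \<partial>lborel)"
  proof (intro nn_integral_cong)
    fix p
    have "(\<integral>\<^sup>+\<omega>. indicator {(p, \<omega>). a \<le> p \<and> p < X \<omega>} (p, \<omega>) \<partial>M)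
        = (\<integral>\<^sup>+\<omega>. indicator {a..} p * indicator {\<omega> \<in> space M. p < X \<omega>} \<omega> \<partial>M)"
      by (intro nn_integral_cong) (auto simp: indicator_def)
    also have "\<dots> = indicator {a..} p * emeasure M {\<omega> \<in> space M. p < X \<omega>}"
      by (subst nn_integral_cmult_indicator) auto
    also have "\<dots> = ennreal (indicator {a..} p * (1 - cdf (distr M borel X) p))"
      by (simp add: one_minus_cdf_distr emeasure_eq_measure indicator_def)
    finally show "(\<integral>\<^sup>+\<omega>. indicator {(p, \<omega>). a \<le> p \<and> p < X \<omega>} (p, \<omega>) \<partial>M)
        = ennreal (indicator {a..} p * (1 - cdf (distr M borel X) p))" .
  qed
  finally show ?thesis .
qed

lemma (in prob_space) integrable_excess_iff_tail:
  fixes X :: "'a \<Rightarrow> real"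
  assumes [measurable]: "X \<in> borel_measurable M"
  shows "integrable M (\<lambda>\<omega>. max (X \<omega> - a) 0)
     \<longleftrightarrow> set_integrable lborel {a..} (\<lambda>p. 1 - cdf (distr M borel X) p)"
proof -
  have nonneg: "0 \<le> indicator {a..} p * (1 - cdf (distr M borel X) p)" for p
    by (simp add: one_minus_cdf_distr)
  show ?thesis
    unfolding set_integrable_def real_scaleR_def
    using nn_integral_excess_eq_tail[OF assms, of a] nonneg
    by (simp add: integrable_iff_bounded one_minus_cdf_distr)
qed

text \<open>When the excess is not integrable, both Bochner integrals take their default value 0.\<close>

lemma (in prob_space) expected_excess_eq_tail_integral:
  fixes X :: "'a \<Rightarrow> real"
  assumes [measurable]: "X \<in> borel_measurable M"
  shows "(\<integral>\<omega>. max (X \<omega> - a) 0 \<partial>M) = (LINT p:{a..}|lborel. 1 - cdf (distr M borel X) p)"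
proof -
  have nonneg: "0 \<le> indicator {a..} p * (1 - cdf (distr M borel X) p)" for p
    by (simp add: one_minus_cdf_distr)
  have "(\<integral>\<omega>. max (X \<omega> - a) 0 \<partial>M) = enn2real (\<integral>\<^sup>+\<omega>. ennreal (max (X \<omega> - a) 0) \<partial>M)"
    by (intro integral_eq_nn_integral) auto
  also have "\<dots> = (LINT p|lborel. indicator {a..} p * (1 - cdf (distr M borel X) p))"
    unfolding nn_integral_excess_eq_tail[OF assms]
    by (intro integral_eq_nn_integral[symmetric]) (use nonneg in auto)
  finally show ?thesis
    by (simp add: set_lebesgue_integral_def)
qed

lemma set_integral_atLeast_split:
  fixes f :: "real \<Rightarrow> real"
  assumes "a \<le> b" and f: "set_integrable lborel {a..} f"
  shows "(LINT p:{a..}|lborel. f p) = (LINT p:{a..<b}|lborel. f p) + (LINT p:{b..}|lborel. f p)"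
proof -
  have "{a..} = {a..<b} \<union> {b..}" using \<open>a \<le> b\<close> by auto
  then show ?thesis
    using \<open>a \<le> b\<close> by (auto intro!: set_integral_Un set_integrable_subset[OF f])
qed

section \<open>The incentive value in terms of tails\<close>

lemma admissible_impact_tail_le:
  "admissible_impact c \<phi> F Fw \<Longrightarrow> 1 - Fw p \<le> 1 - F p"
  unfolding admissible_impact_def by (cases "p < c") auto

locale price_impact = prob_space M + W: prob_space N
  for M :: "'a measure" and N :: "'b measure" +
  fixes P :: "'a \<Rightarrow> real" and Pw :: "'b \<Rightarrow> real" and c \<phi> :: real
  assumes P_measurable [measurable]: "P \<in> borel_measurable M"
    and Pw_measurable [measurable]: "Pw \<in> borel_measurable N"
    and P_pos_integrable: "integrable M (\<lambda>\<omega>. max (P \<omega>) 0)"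
    and admissible: "admissible_impact c \<phi> (cdf (distr M borel P)) (cdf (distr N borel Pw))"
begin

abbreviation "F \<equiv> cdf (distr M borel P)"
abbreviation "Fw \<equiv> cdf (distr N borel Pw)"

lemma tail_integrable: "set_integrable lborel {a..} (\<lambda>p. 1 - F p)"
proof -
  have "integrable M (\<lambda>\<omega>. max (P \<omega> - a) 0)"
    by (rule Bochner_Integration.integrable_bound[of _ "\<lambda>\<omega>. max (P \<omega>) 0 + \<bar>a\<bar>"])
       (use P_pos_integrable in auto)
  then show ?thesis
    by (simp add: integrable_excess_iff_tail)
qed

lemma tail_w_integrable: "set_integrable lborel {a..} (\<lambda>p. 1 - Fw p)"
  unfolding set_integrable_def
proof (rule Bochner_Integration.integrable_bound)
  show "integrable lborel (\<lambda>p. indicator {a..} p *\<^sub>R (1 - F p))"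
    using tail_integrable[of a] by (simp add: set_integrable_def)
  show "(\<lambda>p. indicator {a..} p *\<^sub>R (1 - Fw p)) \<in> borel_measurable lborel"
    by measurable
  have "\<bar>1 - Fw p\<bar> \<le> \<bar>1 - F p\<bar>" for p
    using admissible_impact_tail_le[OF admissible, of p]
    by (simp add: one_minus_cdf_distr W.one_minus_cdf_distr)
  then show "AE p in lborel. norm (indicator {a..} p *\<^sub>R (1 - Fw p))
      \<le> norm (indicator {a..} p *\<^sub>R (1 - F p))"
    by (auto simp: indicator_def)
qed

lemma incentive_value_eq_tails:
  "incentive_value M P N Pw c A K
     = (LINT p:{c..}|lborel. 1 - Fw p) - (LINT p:{K..}|lborel. 1 - Fw p)
       + (LINT p:{K..}|lborel. 1 - F p) - A"
  unfolding incentive_value_def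
  by (simp add: expected_excess_eq_tail_integral W.expected_excess_eq_tail_integral)

lemma incentive_value_strike_le:
  assumes "K \<le> c"
  shows "incentive_value M P N Pw c A K = (\<integral>\<omega>. max (P \<omega> - c) 0 \<partial>M) - A"
proof -
  have "(LINT p:{K..<c}|lborel. 1 - Fw p) = (LINT p:{K..<c}|lborel. 1 - F p)"
    by (rule set_lebesgue_integral_cong) (use admissible in \<open>auto simp: admissible_impact_def\<close>)
  then show ?thesis
    unfolding incentive_value_eq_tails expected_excess_eq_tail_integral[OF P_measurable]
      set_integral_atLeast_split[OF assms tail_integrable]
      set_integral_atLeast_split[OF assms tail_w_integrable]
    by simp
qed

lemma incentive_value_strike_gt:
  assumes "c < K"
  shows "incentive_value M P N Pw c A K
       = (LINT p:{c..<K}|lborel. 1 - Fw p) + (\<integral>\<omega>. max (P \<omega> - K) 0 \<partial>M) - A"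
  unfolding incentive_value_eq_tails expected_excess_eq_tail_integral[OF P_measurable]
    set_integral_atLeast_split[OF less_imp_le[OF assms] tail_w_integrable]
  by simp

text \<open>The same shape as \<open>incentive_value_strike_gt\<close>, with the smallest admissible tail
  in place of that of the counterfactual price.\<close>

lemma incentive_lower_strike_gt:
  assumes "c < K"
  shows "incentive_lower M P c A \<phi> K
       = (LINT p:{c..<K}|lborel. (1 - \<phi>) * (1 - F p)) + (\<integral>\<omega>. max (P \<omega> - K) 0 \<partial>M) - A"
proof -
  have "(\<integral>\<omega>. max (P \<omega> - c) 0 \<partial>M)
      = (LINT p:{c..<K}|lborel. 1 - F p) + (\<integral>\<omega>. max (P \<omega> - K) 0 \<partial>M)"
    unfolding expected_excess_eq_tail_integral[OF P_measurable]
    by (rule set_integral_atLeast_split) (use assms tail_integrable in auto)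
  then show ?thesis
    using assms by (simp add: incentive_lower_def) (simp add: algebra_simps)
qed

lemma incentive_lower_le_value:
  "incentive_lower M P c A \<phi> K \<le> incentive_value M P N Pw c A K"
proof (cases "K \<le> c")
  case True
  then show ?thesis
    by (simp add: incentive_value_strike_le incentive_lower_def)
next
  case False
  have "(LINT p:{c..<K}|lborel. (1 - \<phi>) * (1 - F p)) \<le> (LINT p:{c..<K}|lborel. 1 - Fw p)"
  proof (rule set_integral_mono)
    show "set_integrable lborel {c..<K} (\<lambda>p. (1 - \<phi>) * (1 - F p))"
      by (intro set_integrable_mult_right set_integrable_subset[OF tail_integrable[of c]]) auto
    show "set_integrable lborel {c..<K} (\<lambda>p. 1 - Fw p)"
      by (rule set_integrable_subset[OF tail_w_integrable[of c]]) auto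
  qed (use admissible in \<open>auto simp: admissible_impact_def\<close>)
  then show ?thesis
    using False by (simp add: incentive_value_strike_gt incentive_lower_strike_gt)
qed

lemma incentive_value_eq_lower_of_minimal_tail:
  assumes "\<And>p. c \<le> p \<Longrightarrow> 1 - Fw p = (1 - \<phi>) * (1 - F p)"
  shows "incentive_value M P N Pw c A K = incentive_lower M P c A \<phi> K"
proof (cases "K \<le> c")
  case True
  then show ?thesis
    by (simp add: incentive_value_strike_le incentive_lower_def)
next
  case False
  have "(LINT p:{c..<K}|lborel. 1 - Fw p) = (LINT p:{c..<K}|lborel. (1 - \<phi>) * (1 - F p))"
    by (rule set_lebesgue_integral_cong) (use assms in auto)
  then show ?thesis
    using False by (simp add: incentive_value_strike_gt incentive_lower_strike_gt)
qed

end

section \<open>The extremal law\<close>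

definition minimal_tail_cdf :: "real \<Rightarrow> real \<Rightarrow> (real \<Rightarrow> real) \<Rightarrow> real \<Rightarrow> real" where
  "minimal_tail_cdf c \<phi> F p = (if p < c then F p else 1 - (1 - \<phi>) * (1 - F p))"

lemma admissible_impact_minimal_tail:
  assumes "0 \<le> \<phi>" and "\<And>p. F p \<le> 1"
  shows "admissible_impact c \<phi> F (minimal_tail_cdf c \<phi> F)"
proof -
  have "(1 - \<phi>) * (1 - F p) \<le> 1 * (1 - F p)" for p
    using assms by (intro mult_right_mono) auto
  then show ?thesis
    by (simp add: admissible_impact_def minimal_tail_cdf_def)
qed

text \<open>The change of formula at \<open>c\<close> only adds an upward jump, and the second formula applies at
  \<open>c\<close> itself; this is what keeps monotonicity and right continuity.\<close>

lemma (in real_distribution) minimal_tail_law: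
  assumes "0 \<le> \<phi>" and "\<phi> \<le> 1"
  obtains \<nu> where "real_distribution \<nu>" and "cdf \<nu> = minimal_tail_cdf c \<phi> (cdf M)"
proof
  let ?G = "minimal_tail_cdf c \<phi> (cdf M)"
  have mono: "?G x \<le> ?G y" if "x \<le> y" for x y
  proof -
    have *: "cdf M x \<le> cdf M y" and **: "cdf M y \<le> 1"
      using that by (auto simp: cdf_nondecreasing cdf_bounded_prob)
    have "(1 - \<phi>) * (1 - cdf M y) \<le> 1 * (1 - cdf M y)"
      using assms ** by (intro mult_right_mono) auto
    moreover have "(1 - \<phi>) * (1 - cdf M y) \<le> (1 - \<phi>) * (1 - cdf M x)"
      using assms * by (intro mult_left_mono) auto
    ultimately show ?thesis
      using that * by (auto simp: minimal_tail_cdf_def)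
  qed
  have right_cont: "continuous (at_right a) ?G" for a
  proof (cases "a < c")
    case True
    have "\<forall>\<^sub>F x in at_right a. cdf M x = ?G x"
      unfolding eventually_at_right_field
      using True by (intro exI[of _ c]) (auto simp: minimal_tail_cdf_def)
    moreover have "(cdf M \<longlongrightarrow> ?G a) (at_right a)"
      using cdf_is_right_cont[of a] True by (simp add: continuous_within minimal_tail_cdf_def)
    ultimately show ?thesis
      unfolding continuous_within by (rule Lim_transform_eventually[rotated])
  next
    case False
    have "\<forall>\<^sub>F x in at_right a. 1 - (1 - \<phi>) * (1 - cdf M x) = ?G x"
      unfolding eventually_at_right_field
      using False by (intro exI[of _ "a + 1"]) (auto simp: minimal_tail_cdf_def)
    moreover have "((\<lambda>x. 1 - (1 - \<phi>) * (1 - cdf M x)) \<longlongrightarrow> ?G a) (at_right a)"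
      using cdf_is_right_cont[of a] False
      by (simp add: continuous_within minimal_tail_cdf_def tendsto_intros)
    ultimately show ?thesis
      unfolding continuous_within by (rule Lim_transform_eventually[rotated])
  qed
  have bot: "(?G \<longlongrightarrow> 0) at_bot"
    using cdf_lim_at_bot
    by (rule Lim_transform_eventually)
       (auto simp: minimal_tail_cdf_def intro: eventually_mono[OF eventually_gt_at_bot[of c]])
  have "((\<lambda>x. 1 - (1 - \<phi>) * (1 - cdf M x)) \<longlongrightarrow> 1 - (1 - \<phi>) * (1 - 1)) at_top"
    by (intro tendsto_intros cdf_lim_at_top_prob)
  moreover have "\<forall>\<^sub>F x in at_top. 1 - (1 - \<phi>) * (1 - cdf M x) = ?G x"
    using eventually_ge_at_top[of c] by eventually_elim (simp add: minimal_tail_cdf_def)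
  ultimately have top: "(?G \<longlongrightarrow> 1) at_top"
    by (simp add: Lim_transform_eventually)
  show "real_distribution (interval_measure ?G)"
    using mono right_cont bot top by (rule real_distribution_interval_measure)
  show "cdf (interval_measure ?G) = ?G"
    using mono right_cont bot by (rule cdf_interval_measure)
qed

section \<open>The bound and its tightness\<close>

theorem theorem6:
  fixes M :: "'a measure" and P :: "'a \<Rightarrow> real" and c A \<phi> :: real
  assumes "prob_space M"
    and "P \<in> borel_measurable M"
    and "integrable M (\<lambda>\<omega>. max (P \<omega>) 0)"
    and "0 \<le> \<phi>" and "\<phi> \<le> 1"
  shows "(\<forall>(N :: 'b measure) (Pw :: 'b \<Rightarrow> real).
            prob_space N \<longrightarrow> Pw \<in> borel_measurable N \<longrightarrow>
            admissible_impact c \<phi> (cdf (distr M borel P)) (cdf (distr N borel Pw)) \<longrightarrow>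
            (\<forall>K. incentive_value M P N Pw c A K \<ge> incentive_lower M P c A \<phi> K))
       \<and> (\<forall>K J :: real.
            (\<forall>\<nu> :: real measure. real_distribution \<nu> \<longrightarrow>
               admissible_impact c \<phi> (cdf (distr M borel P)) (cdf \<nu>) \<longrightarrow>
               incentive_value M P \<nu> (\<lambda>x. x) c A K \<ge> J) \<longrightarrow>
            J \<le> incentive_lower M P c A \<phi> K)"
proof (intro conjI allI impI)
  fix N :: "'b measure" and Pw K
  assume "prob_space N" and "Pw \<in> borel_measurable N"
    and "admissible_impact c \<phi> (cdf (distr M borel P)) (cdf (distr N borel Pw))"
  then interpret price_impact M N P Pw c \<phi>
    using assms by (simp add: price_impact_def price_impact_axioms_def)
  show "incentive_value M P N Pw c A K \<ge> incentive_lower M P c A \<phi> K"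
    by (rule incentive_lower_le_value)
next
  fix K J :: real
  assume J: "\<forall>\<nu> :: real measure. real_distribution \<nu> \<longrightarrow>
               admissible_impact c \<phi> (cdf (distr M borel P)) (cdf \<nu>) \<longrightarrow>
               incentive_value M P \<nu> (\<lambda>x. x) c A K \<ge> J"
  let ?F = "cdf (distr M borel P)"
  interpret D: real_distribution "distr M borel P"
    using assms by (intro prob_space.real_distribution_distr)
  obtain \<nu> where \<nu>: "real_distribution \<nu>" and cdf_\<nu>: "cdf \<nu> = minimal_tail_cdf c \<phi> ?F"
    using D.minimal_tail_law[OF assms(4,5)] .
  interpret \<nu>: real_distribution \<nu> by (rule \<nu>)
  have admissible: "admissible_impact c \<phi> ?F (cdf \<nu>)"
    unfolding cdf_\<nu> by (rule admissible_impact_minimal_tail) (use assms D.cdf_bounded_prob in auto)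
  have law: "distr \<nu> borel (\<lambda>x. x) = \<nu>"
    by (rule distr_id2) simp
  have impact: "price_impact M \<nu> P (\<lambda>x. x) c \<phi>"
  proof (intro price_impact.intro price_impact_axioms.intro)
    show "admissible_impact c \<phi> ?F (cdf (distr \<nu> borel (\<lambda>x. x)))"
      unfolding law by (rule admissible)
    show "(\<lambda>x. x) \<in> borel_measurable \<nu>"
      by (rule \<nu>.measurable_finite_borel) simp
  qed (fact assms \<nu>.prob_space_axioms)+
  have "J \<le> incentive_value M P \<nu> (\<lambda>x. x) c A K"
    using J \<nu> admissible by blast
  also have "\<dots> = incentive_lower M P c A \<phi> K"
    by (rule price_impact.incentive_value_eq_lower_of_minimal_tail[OF impact])
       (simp add: law cdf_\<nu> minimal_tail_cdf_def)
  finally show "J \<le> incentive_lower M P c A \<phi> K" .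
qed

end
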